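(* Let $M$ be a 3-dimensional Riemannian manifold with metric tensor $g$ and $(1,1)$-tensor field $q$ whose components in local coordinates are the matrices $(g_{ij})$, $(q_i^{.j})$ given in the context. Suppose $q$ is parallel, i.e. $\nabla q=0$. Let $p\in M$ and let $x=(x^1,x^2,x^3)$ be an arbitrary vector in $T_pM$ satisfying $$3x^1x^2x^3\neq (x^1)^3+(x^2)^3+(x^3)^3 .$$ Then the sectional curvatures of the 2-planes $L_1=\{x,qx\}$, $L_2=\{qx,q^2x\}$, $L_3=\{q^2x,x\}$ are equal: $\mu(L_1;p)=\mu(L_2;p)=\mu(L_3;p)$.
   Context: In the local coordinates $(X^1,X^2,X^3)$ on a coordinate neighborhood $F\subset\mathbb{R}^3$ the component matrices are $$(g_{ij})=\begin{pmatrix} A & B & B \\ B & A & B \\ B & B & A \end{pmatrix},\qquad (q_i^{.j})=\begin{pmatrix} 0 & 1 & 0 \\ 0 & 0 & 1 \\ 1 & 0 & 0 \end{pmatrix},$$ where $A,B$ are smooth functions on $F$ with $A>B>0$; the lower index is the row index and $q e_i=\sum_j q_i^{.j}e_j$ for the coordinate basis $e_i=\partial/\partial X^i$. Vector components $(x^1,x^2,x^3)$ are with respect to this basis. $\nabla$ is the Levi-Civita connection of $g$, $R(x,y)z=\nabla_x\nabla_yz-\nabla_y\nabla_xz-\nabla_{[x,y]}z$, and $R(x,y,z,u)=g(R(x,y)z,u)$. For linearly independent $x,y\in T_pM$, the sectional curvature of the 2-plane $L=\{x,y\}$ spanned by $x,y$ is (with this paper's sign convention) $$\mu(L;p)=\frac{R(x,y,x,y)}{g(x,x)g(y,y)-g^2(x,y)}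 .$$ The condition on $x$ in the statement means that $x,qx,q^2x$ are linearly independent. *)

theory Defs
  imports "HOL-Analysis.Analysis"
begin

text \<open>Smoothness is only meant for open domains: a function is of class \<open>C\<^sup>k\<^sup>+\<^sup>1\<close> if it is
  differentiable and every directional derivative is of class \<open>C\<^sup>k\<close>.\<close>

primrec Ck_on :: "nat \<Rightarrow> 'a set \<Rightarrow> ('a::real_normed_vector \<Rightarrow> 'b::real_normed_vector) \<Rightarrow> bool" where
  "Ck_on 0 S f \<longleftrightarrow> continuous_on S f"
| "Ck_on (Suc k) S f \<longleftrightarrow>
     (\<forall>x\<in>S. f differentiable (at x)) \<and> (\<forall>v. Ck_on k S (\<lambda>x. frechet_derivative f (at x) v))"

definition smooth_on :: "'a set \<Rightarrow> ('a::real_normed_vector \<Rightarrow> 'b::real_normed_vector) \<Rightarrow> bool" where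
  "smooth_on S f \<longleftrightarrow> (\<forall>k. Ck_on k S f)"


text \<open>Tensors at a point, given by their components in the coordinate basis. A metric is given by
  its Gram matrix. A (1,1)-tensor is given by the matrix \<open>Q\<close> with \<open>q e\<^sub>i = \<Sum>\<^sub>j Q $ i $ j e\<^sub>j\<close>
  (the row index is the lower one), hence it acts on component vectors from the right.\<close>

definition metric_form :: "real^3^3 \<Rightarrow> real^3 \<Rightarrow> real^3 \<Rightarrow> real" where
  "metric_form G u v = u \<bullet> (G *v v)"

definition tensor_apply :: "real^3^3 \<Rightarrow> real^3 \<Rightarrow> real^3" where
  "tensor_apply Q x = x v* Q"


text \<open>Vector fields on an open set \<open>F\<close> of coordinate values are given by their components
  in the coordinate basis; values outside of \<open>F\<close> are irrelevant.\<close>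

type_synonym vfield = "real^3 \<Rightarrow> real^3"
type_synonym connection = "vfield \<Rightarrow> vfield \<Rightarrow> vfield"

definition dir_deriv :: "vfield \<Rightarrow> (real^3 \<Rightarrow> 'b::real_normed_vector) \<Rightarrow> real^3 \<Rightarrow> 'b" where
  "dir_deriv X f P = frechet_derivative f (at P) (X P)"

definition lie_bracket :: "vfield \<Rightarrow> vfield \<Rightarrow> vfield" where
  "lie_bracket X Y = (\<lambda>P. dir_deriv X Y P - dir_deriv Y X P)"

definition affine_connection :: "(real^3) set \<Rightarrow> connection \<Rightarrow> bool" where
  "affine_connection F nab \<longleftrightarrow>
    (\<forall>X Y. smooth_on F X \<longrightarrow> smooth_on F Y \<longrightarrow> smooth_on F (nab X Y)) \<and>
    (\<forall>X Y Z. smooth_on F X \<longrightarrow> smooth_on F Y \<longrightarrow> smooth_on F Z \<longrightarrow>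
      (\<forall>P\<in>F. nab (\<lambda>R. X R + Y R) Z P = nab X Z P + nab Y Z P)) \<and>
    (\<forall>X Y Z. smooth_on F X \<longrightarrow> smooth_on F Y \<longrightarrow> smooth_on F Z \<longrightarrow>
      (\<forall>P\<in>F. nab X (\<lambda>R. Y R + Z R) P = nab X Y P + nab X Z P)) \<and>
    (\<forall>(f :: real^3 \<Rightarrow> real) X Y. smooth_on F f \<longrightarrow> smooth_on F X \<longrightarrow> smooth_on F Y \<longrightarrow>
      (\<forall>P\<in>F. nab (\<lambda>R. f R *\<^sub>R X R) Y P = f P *\<^sub>R nab X Y P)) \<and>
    (\<forall>(f :: real^3 \<Rightarrow> real) X Y. smooth_on F f \<longrightarrow> smooth_on F X \<longrightarrow> smooth_on F Y \<longrightarrow>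
      (\<forall>P\<in>F. nab X (\<lambda>R. f R *\<^sub>R Y R) P = dir_deriv X f P *\<^sub>R Y P + f P *\<^sub>R nab X Y P))"

definition levi_civita :: "(real^3) set \<Rightarrow> (real^3 \<Rightarrow> real^3^3) \<Rightarrow> connection \<Rightarrow> bool" where
  "levi_civita F G nab \<longleftrightarrow>
    affine_connection F nab \<and>
    (\<forall>X Y. smooth_on F X \<longrightarrow> smooth_on F Y \<longrightarrow>
      (\<forall>P\<in>F. nab X Y P - nab Y X P = lie_bracket X Y P)) \<and>
    (\<forall>X Y Z. smooth_on F X \<longrightarrow> smooth_on F Y \<longrightarrow> smooth_on F Z \<longrightarrow>
      (\<forall>P\<in>F. dir_deriv X (\<lambda>R. metric_form (G R) (Y R) (Z R)) P =
         metric_form (G P) (nab X Y P) (Z P) + metric_form (G P) (Y P) (nab X Z P)))"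

definition cov_deriv_tensor :: "connection \<Rightarrow> (real^3 \<Rightarrow> real^3^3) \<Rightarrow> vfield \<Rightarrow> vfield \<Rightarrow> vfield" where
  "cov_deriv_tensor nab Q X Y = (\<lambda>P.
     nab X (\<lambda>R. tensor_apply (Q R) (Y R)) P - tensor_apply (Q P) (nab X Y P))"

definition parallel_on :: "(real^3) set \<Rightarrow> connection \<Rightarrow> (real^3 \<Rightarrow> real^3^3) \<Rightarrow> bool" where
  "parallel_on F nab Q \<longleftrightarrow>
    (\<forall>X Y. smooth_on F X \<longrightarrow> smooth_on F Y \<longrightarrow> (\<forall>P\<in>F. cov_deriv_tensor nab Q X Y P = 0))"

definition curvature :: "connection \<Rightarrow> vfield \<Rightarrow> vfield \<Rightarrow> vfield \<Rightarrow> vfield" where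
  "curvature nab X Y Z = (\<lambda>P.
     nab X (nab Y Z) P - nab Y (nab X Z) P - nab (lie_bracket X Y) Z P)"

text \<open>On tangent vectors at \<open>P\<close> the curvature is evaluated by extending the vectors to the fields with
  constant components; by tensoriality any other smooth extension gives the same value.\<close>

definition curvature4 ::
    "(real^3 \<Rightarrow> real^3^3) \<Rightarrow> connection \<Rightarrow> real^3 \<Rightarrow> real^3 \<Rightarrow> real^3 \<Rightarrow> real^3 \<Rightarrow> real^3 \<Rightarrow> real" where
  "curvature4 G nab P x y z u =
     metric_form (G P) (curvature nab (\<lambda>_. x) (\<lambda>_. y) (\<lambda>_. z) P) u"

text \<open>The sign is opposite to the usual one: \<open>R(x,y,x,y)\<close> instead of \<open>R(x,y,y,x)\<close>.\<close>

definition sectional_curvature ::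
    "(real^3 \<Rightarrow> real^3^3) \<Rightarrow> connection \<Rightarrow> real^3 \<Rightarrow> real^3 \<Rightarrow> real^3 \<Rightarrow> real" where
  "sectional_curvature G nab P x y =
     curvature4 G nab P x y x y /
     (metric_form (G P) x x * metric_form (G P) y y - (metric_form (G P) x y)\<^sup>2)"


text \<open>The manifold is a Hausdorff, second countable type \<open>'m\<close> with an atlas of charts
  \<open>(U, \<phi>)\<close>. Tensor fields on it are families of components, one for each chart of the atlas, as
  functions of the coordinates, which satisfy the tensor transformation law on overlaps.\<close>

type_synonym 'm chart = "'m set \<times> ('m \<Rightarrow> real^3)"

definition chart_image :: "'m chart \<Rightarrow> (real^3) set" where
  "chart_image c = snd c ` fst c"

definition transition :: "'m chart \<Rightarrow> 'm chart \<Rightarrow> real^3 \<Rightarrow> real^3" where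
  "transition c d = snd d \<circ> inv_into (fst c) (snd c)"

definition smooth_atlas :: "('m::{t2_space,second_countable_topology}) chart set \<Rightarrow> bool" where
  "smooth_atlas \<A> \<longleftrightarrow>
    (\<Union>c\<in>\<A>. fst c) = UNIV \<and>
    (\<forall>c\<in>\<A>. open (fst c) \<and> open (chart_image c) \<and>
       homeomorphism (fst c) (chart_image c) (snd c) (inv_into (fst c) (snd c))) \<and>
    (\<forall>c\<in>\<A>. \<forall>d\<in>\<A>. smooth_on (snd c ` (fst c \<inter> fst d)) (transition c d))"

definition jacobian_map :: "'m chart \<Rightarrow> 'm chart \<Rightarrow> 'm \<Rightarrow> real^3 \<Rightarrow> real^3" where
  "jacobian_map c d p = frechet_derivative (transition c d) (at (snd c p))"

definition riemannian_metric :: "'m chart set \<Rightarrow> ('m chart \<Rightarrow> real^3 \<Rightarrow> real^3^3) \<Rightarrow> bool" where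
  "riemannian_metric \<A> g \<longleftrightarrow>
    (\<forall>c\<in>\<A>. smooth_on (chart_image c) (g c) \<and>
       (\<forall>P\<in>chart_image c. transpose (g c P) = g c P \<and>
          (\<forall>v. v \<noteq> 0 \<longrightarrow> metric_form (g c P) v v > 0))) \<and>
    (\<forall>c\<in>\<A>. \<forall>d\<in>\<A>. \<forall>p\<in>fst c \<inter> fst d. \<forall>u v.
       metric_form (g d (snd d p)) (jacobian_map c d p u) (jacobian_map c d p v) =
       metric_form (g c (snd c p)) u v)"

definition tensor_field_11 :: "'m chart set \<Rightarrow> ('m chart \<Rightarrow> real^3 \<Rightarrow> real^3^3) \<Rightarrow> bool" where
  "tensor_field_11 \<A> q \<longleftrightarrow>
    (\<forall>c\<in>\<A>. smooth_on (chart_image c) (q c)) \<and>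
    (\<forall>c\<in>\<A>. \<forall>d\<in>\<A>. \<forall>p\<in>fst c \<inter> fst d. \<forall>u.
       tensor_apply (q d (snd d p)) (jacobian_map c d p u) =
       jacobian_map c d p (tensor_apply (q c (snd c p)) u))"

text \<open>The Levi-Civita connection of the manifold is given by its restrictions to the chart domains.
  These agree on overlaps since the Levi-Civita connection of a metric is unique.\<close>

definition levi_civita_connection ::
    "'m chart set \<Rightarrow> ('m chart \<Rightarrow> real^3 \<Rightarrow> real^3^3) \<Rightarrow> ('m chart \<Rightarrow> connection) \<Rightarrow> bool" where
  "levi_civita_connection \<A> g nab \<longleftrightarrow> (\<forall>c\<in>\<A>. levi_civita (chart_image c) (g c) (nab c))"

definition parallel_tensor ::
    "'m chart set \<Rightarrow> ('m chart \<Rightarrow> connection) \<Rightarrow> ('m chart \<Rightarrow> real^3 \<Rightarrow> real^3^3) \<Rightarrow> bool" where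
  "parallel_tensor \<A> nab q \<longleftrightarrow> (\<forall>c\<in>\<A>. parallel_on (chart_image c) (nab c) (q c))"

end

theory Submission
  imports Defs
begin

text \<open>Since \<open>q\<close> is parallel, \<open>R(x,y)\<close> commutes with \<open>q\<close>, and \<open>q\<close> is an isometry of \<open>g\<close>; hence
  \<open>R(x,y,qz,qu) = R(x,y,z,u)\<close>. By the pair symmetry of \<open>R\<close> also \<open>R(qx,qy,z,u) = R(x,y,z,u)\<close>, so the
  planes \<open>{x,y}\<close> and \<open>{qx,qy}\<close> have the same sectional curvature. Since \<open>q\<^sup>3 = id\<close>, the three planes
  in question are \<open>L\<^sub>1\<close>, \<open>qL\<^sub>1\<close> and \<open>q\<^sup>2L\<^sub>1\<close>.\<close>

section \<open>Symmetry of second derivatives\<close>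

text \<open>Chain rule along a line; it lets the one-variable mean value theorem act on directional
  derivatives.\<close>

lemma has_derivative_along_line:
  fixes f :: "'a::real_normed_vector \<Rightarrow> 'b::real_normed_vector"
  assumes "f differentiable (at (Q + s *\<^sub>R x))"
  shows "((\<lambda>s. f (Q + s *\<^sub>R x)) has_derivative
           (\<lambda>h. h *\<^sub>R frechet_derivative f (at (Q + s *\<^sub>R x)) x)) (at s within T)"
proof -
  have "((\<lambda>s. Q + s *\<^sub>R x) has_derivative (\<lambda>h. h *\<^sub>R x)) (at s within T)"
    by (auto intro!: derivative_eq_intros)
  moreover have "(f has_derivative frechet_derivative f (at (Q + s *\<^sub>R x))) (at (Q + s *\<^sub>R x))"
    using assms by (simp add: frechet_derivative_works)
  ultimately have "(f \<circ> (\<lambda>s. Q + s *\<^sub>R x) has_derivative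
      frechet_derivative f (at (Q + s *\<^sub>R x)) \<circ> (\<lambda>h. h *\<^sub>R x)) (at s within T)"
    by (intro diff_chain_within) (auto intro: has_derivative_at_withinI)
  moreover have "linear (frechet_derivative f (at (Q + s *\<^sub>R x)))"
    using assms by (rule linear_frechet_derivative)
  ultimately show ?thesis
    by (simp add: o_def linear_cmul)
qed

text \<open>Mean value theorem twice: first in \<open>s\<close> for the increment of
  \<open>f\<close> in direction \<open>t *\<^sub>R y\<close>, regarded as a function along
  \<open>x\<close>, then in \<open>r\<close> for the resulting increment of the derivative along
  \<open>x\<close>.\<close>

lemma mixed_difference_mvt:
  fixes f :: "'a::real_normed_vector \<Rightarrow> real"
  assumes t: "0 < t"
    and S: "\<And>s r. s \<in> {0..t} \<Longrightarrow> r \<in> {0..t} \<Longrightarrow> P + s *\<^sub>R x + r *\<^sub>R y \<in> S"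
    and f: "\<And>Q. Q \<in> S \<Longrightarrow> f differentiable (at Q)"
    and fx: "\<And>Q. Q \<in> S \<Longrightarrow> (\<lambda>R. frechet_derivative f (at R) x) differentiable (at Q)"
  obtains s r where "s \<in> {0..t}" "r \<in> {0..t}"
    "f (P + t *\<^sub>R x + t *\<^sub>R y) - f (P + t *\<^sub>R x) - f (P + t *\<^sub>R y) + f P =
     t\<^sup>2 * frechet_derivative (\<lambda>R. frechet_derivative f (at R) x) (at (P + s *\<^sub>R x + r *\<^sub>R y)) y"
proof -
  define D where "D = (\<lambda>R. frechet_derivative f (at R) x)"
  have "\<exists>s\<in>{0<..<t}. (f (P + t *\<^sub>R y + t *\<^sub>R x) - f (P + t *\<^sub>R x)) -
      (f (P + t *\<^sub>R y + 0 *\<^sub>R x) - f (P + 0 *\<^sub>R x)) =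
      (t - 0) *\<^sub>R D (P + t *\<^sub>R y + s *\<^sub>R x) - (t - 0) *\<^sub>R D (P + s *\<^sub>R x)"
  proof (rule mvt_simple[OF t])
    fix s assume "0 \<le> s" "s \<le> t"
    with S[of s t] S[of s 0] t have "P + t *\<^sub>R y + s *\<^sub>R x \<in> S" "P + s *\<^sub>R x \<in> S"
      by (simp_all add: ac_simps)
    then show "((\<lambda>s. f (P + t *\<^sub>R y + s *\<^sub>R x) - f (P + s *\<^sub>R x)) has_derivative
        (\<lambda>h. h *\<^sub>R D (P + t *\<^sub>R y + s *\<^sub>R x) - h *\<^sub>R D (P + s *\<^sub>R x))) (at s within {0..t})"
      unfolding D_def by (intro has_derivative_diff has_derivative_along_line f)
  qed
  then obtain s where s: "s \<in> {0<..<t}" and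
    eq1: "f (P + t *\<^sub>R x + t *\<^sub>R y) - f (P + t *\<^sub>R x) - f (P + t *\<^sub>R y) + f P =
      t * (D (P + s *\<^sub>R x + t *\<^sub>R y) - D (P + s *\<^sub>R x))"
    by (auto simp: algebra_simps)
  have "\<exists>r\<in>{0<..<t}. D (P + s *\<^sub>R x + t *\<^sub>R y) - D (P + s *\<^sub>R x + 0 *\<^sub>R y) =
      (t - 0) *\<^sub>R frechet_derivative D (at (P + s *\<^sub>R x + r *\<^sub>R y)) y"
  proof (rule mvt_simple[OF t])
    fix r assume "0 \<le> r" "r \<le> t"
    with s have "P + s *\<^sub>R x + r *\<^sub>R y \<in> S" by (intro S) auto
    then show "((\<lambda>r. D (P + s *\<^sub>R x + r *\<^sub>R y)) has_derivative
        (\<lambda>h. h *\<^sub>R frechet_derivative D (at (P + s *\<^sub>R x + r *\<^sub>R y)) y)) (at r within {0..t})"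
      by (intro has_derivative_along_line) (simp add: D_def fx)
  qed
  then obtain r where r: "r \<in> {0<..<t}" and
    "D (P + s *\<^sub>R x + t *\<^sub>R y) - D (P + s *\<^sub>R x) =
      t * frechet_derivative D (at (P + s *\<^sub>R x + r *\<^sub>R y)) y"
    by auto
  with eq1 have "f (P + t *\<^sub>R x + t *\<^sub>R y) - f (P + t *\<^sub>R x) - f (P + t *\<^sub>R y) + f P =
      t\<^sup>2 * frechet_derivative D (at (P + s *\<^sub>R x + r *\<^sub>R y)) y"
    by (simp add: power2_eq_square)
  with s r that[of s r] show thesis unfolding D_def by simp
qed

text \<open>Schwarz's theorem: the second-order mixed difference is symmetric in \<open>x\<close>
  and \<open>y\<close>, so both mixed derivatives take a common value at points arbitrarily near
  \<open>P\<close>, and continuity carries this to \<open>P\<close>.\<close>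

lemma frechet_derivative_commute:
  fixes f :: "'a::real_normed_vector \<Rightarrow> real"
  assumes "open S" "P \<in> S"
    and f: "\<And>Q. Q \<in> S \<Longrightarrow> f differentiable (at Q)"
    and fx: "\<And>Q. Q \<in> S \<Longrightarrow> (\<lambda>R. frechet_derivative f (at R) x) differentiable (at Q)"
    and fy: "\<And>Q. Q \<in> S \<Longrightarrow> (\<lambda>R. frechet_derivative f (at R) y) differentiable (at Q)"
    and fxy: "continuous_on S (\<lambda>Q. frechet_derivative (\<lambda>R. frechet_derivative f (at R) x) (at Q) y)"
    and fyx: "continuous_on S (\<lambda>Q. frechet_derivative (\<lambda>R. frechet_derivative f (at R) y) (at Q) x)"
  shows "frechet_derivative (\<lambda>R. frechet_derivative f (at R) x) (at P) y =
         frechet_derivative (\<lambda>R. frechet_derivative f (at R) y) (at P) x"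
proof -
  define a where "a = (\<lambda>Q. frechet_derivative (\<lambda>R. frechet_derivative f (at R) x) (at Q) y)"
  define b where "b = (\<lambda>Q. frechet_derivative (\<lambda>R. frechet_derivative f (at R) y) (at Q) x)"
  have small: "\<bar>a P - b P\<bar> \<le> e" if e: "e > 0" for e
  proof -
    have "isCont a P" "isCont b P"
      using fxy fyx assms(1,2) unfolding a_def b_def by (simp_all add: continuous_on_eq_continuous_at)
    then have "\<exists>d>0. \<forall>Q. dist Q P < d \<longrightarrow> dist (a Q) (a P) < e / 2"
      and "\<exists>d>0. \<forall>Q. dist Q P < d \<longrightarrow> dist (b Q) (b P) < e / 2"
      using half_gt_zero[OF e] unfolding continuous_at_eps_delta by blast+
    then obtain d1 d2 where d12: "d1 > 0" "d2 > 0"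
      and a: "\<And>Q. dist Q P < d1 \<Longrightarrow> dist (a Q) (a P) < e / 2"
      and b: "\<And>Q. dist Q P < d2 \<Longrightarrow> dist (b Q) (b P) < e / 2"
      by auto
    obtain d3 where d3: "d3 > 0" "\<And>Q. dist Q P < d3 \<Longrightarrow> Q \<in> S"
      using openE[OF assms(1,2)] by (metis dist_commute mem_ball subsetD)
    define d where "d = min d1 (min d2 d3)"
    \<comment> \<open>This size keeps the whole parallelogram spanned by
      \<open>t *\<^sub>R x\<close> and \<open>t *\<^sub>R y\<close> at distance less than
      \<open>d\<close> from \<open>P\<close>; the summand 1 makes the bound strict and covers
      \<open>x = y = 0\<close>.\<close>
    define t where "t = d / (norm x + norm y + 1)"
    have den: "norm x + norm y + 1 > 0"
      by (simp add: add_nonneg_pos)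
    have t: "t > 0"
      using d12 d3 den by (simp add: t_def d_def)
    have near: "dist (P + s *\<^sub>R x + r *\<^sub>R y) P < d" if "s \<in> {0..t}" "r \<in> {0..t}" for s r
    proof -
      have "dist (P + s *\<^sub>R x + r *\<^sub>R y) P = norm (s *\<^sub>R x + r *\<^sub>R y)"
        by (simp add: dist_norm algebra_simps)
      also have "\<dots> \<le> s * norm x + r * norm y"
        using that norm_triangle_ineq[of "s *\<^sub>R x" "r *\<^sub>R y"] by simp
      also have "\<dots> \<le> t * norm x + t * norm y"
        using that by (intro add_mono mult_right_mono) auto
      also have "\<dots> < t * (norm x + norm y + 1)"
        using t by (simp add: algebra_simps)
      also have "\<dots> = d"
        using den by (simp add: t_def)
      finally show ?thesis .
    qed
    then have S: "P + s *\<^sub>R x + r *\<^sub>R y \<in> S" if "s \<in> {0..t}" "r \<in> {0..t}" for s r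
      using d3(2) near[OF that] by (simp add: d_def)
    define \<Delta> where "\<Delta> = f (P + t *\<^sub>R x + t *\<^sub>R y) - f (P + t *\<^sub>R x) - f (P + t *\<^sub>R y) + f P"
    obtain s r where 1: "s \<in> {0..t}" "r \<in> {0..t}" "\<Delta> = t\<^sup>2 * a (P + s *\<^sub>R x + r *\<^sub>R y)"
      unfolding \<Delta>_def a_def by (rule mixed_difference_mvt[OF t S f fx])
    \<comment> \<open>The same mixed difference is expanded with the roles of \<open>x\<close> and
      \<open>y\<close> exchanged.\<close>
    obtain r' s' where 2: "r' \<in> {0..t}" "s' \<in> {0..t}"
      and "f (P + t *\<^sub>R y + t *\<^sub>R x) - f (P + t *\<^sub>R y) - f (P + t *\<^sub>R x) + f P =
        t\<^sup>2 * b (P + r' *\<^sub>R y + s' *\<^sub>R x)"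
      unfolding b_def
    proof (rule mixed_difference_mvt[OF t _ f fy])
      show "P + u *\<^sub>R y + v *\<^sub>R x \<in> S" if "u \<in> {0..t}" "v \<in> {0..t}" for u v
        using S[OF that(2,1)] by (simp add: ac_simps)
    qed
    then have "\<Delta> = t\<^sup>2 * b (P + s' *\<^sub>R x + r' *\<^sub>R y)"
      by (simp add: \<Delta>_def ac_simps)
    with 1 t have "a (P + s *\<^sub>R x + r *\<^sub>R y) = b (P + s' *\<^sub>R x + r' *\<^sub>R y)"
      by simp
    moreover have "dist (a (P + s *\<^sub>R x + r *\<^sub>R y)) (a P) < e / 2"
      using near[OF 1(1,2)] by (intro a) (simp add: d_def)
    moreover have "dist (b (P + s' *\<^sub>R x + r' *\<^sub>R y)) (b P) < e / 2"
      using near[OF 2(2,1)] by (intro b) (simp add: d_def)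
    ultimately show ?thesis
      unfolding dist_real_def by linarith
  qed
  \<comment> \<open>A nonzero gap would be at most half of itself.\<close>
  have "a P = b P"
    using small[of "\<bar>a P - b P\<bar> / 2"] by (cases "a P = b P") auto
  then show ?thesis
    unfolding a_def b_def .
qed

section \<open>Smooth functions on open sets\<close>

lemma differentiable_transform_within_open:
  assumes "f differentiable (at x)" "open S" "x \<in> S" "\<And>y. y \<in> S \<Longrightarrow> f y = g y"
  shows "g differentiable (at x)"
  using assms unfolding differentiable_def by (meson has_derivative_transform_within_open)

text \<open>On an open set derivatives see only nearby values, so equality on \<open>S\<close>
  passes to all directional derivatives; the induction therefore ranges over arbitrary
  \<open>f\<close> and \<open>g\<close>.\<close>

lemma Ck_on_cong:
  assumes "open S" "\<And>x. x \<in> S \<Longrightarrow> f x = g x"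
  shows "Ck_on k S f \<longleftrightarrow> Ck_on k S g"
proof -
  have "Ck_on k S g" if "Ck_on k S f" "\<And>x. x \<in> S \<Longrightarrow> f x = g x" for f g
    using that
  proof (induction k arbitrary: f g)
    case 0
    then show ?case by (simp cong: continuous_on_cong)
  next
    case (Suc k)
    have "g differentiable (at x)" if "x \<in> S" for x
      using Suc.prems that assms(1) differentiable_transform_within_open[of f x S g] by simp
    moreover have "frechet_derivative f (at x) v = frechet_derivative g (at x) v" if "x \<in> S" for x v
      using frechet_derivative_transform_within_open[of f x S g] Suc.prems that assms(1) by simp
    with Suc have "Ck_on k S (\<lambda>x. frechet_derivative g (at x) v)" for v
      by (metis (no_types, lifting) Ck_on.simps(2))
    ultimately show ?case by simp
  qed
  then show ?thesis using assms(2) by metis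
qed

lemma smooth_on_cong:
  assumes "open S" "\<And>x. x \<in> S \<Longrightarrow> f x = g x"
  shows "smooth_on S f \<longleftrightarrow> smooth_on S g"
  using Ck_on_cong[OF assms] by (simp add: smooth_on_def)

lemma smooth_on_const: "smooth_on S (\<lambda>_. c)"
proof -
  have "Ck_on k S (\<lambda>_. c)" for k
    by (induction k arbitrary: c) (auto simp: differentiable_const)
  then show ?thesis by (simp add: smooth_on_def)
qed

lemma smooth_on_differentiable: "smooth_on S f \<Longrightarrow> x \<in> S \<Longrightarrow> f differentiable (at x)"
  by (metis Ck_on.simps(2) smooth_on_def)

lemma smooth_on_continuous_on: "smooth_on S f \<Longrightarrow> continuous_on S f"
  by (metis Ck_on.simps(1) smooth_on_def)

lemma dir_deriv_cong:
  assumes "open F" "P \<in> F" "f differentiable (at P)" "\<And>Q. Q \<in> F \<Longrightarrow> f Q = g Q"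
  shows "dir_deriv X f P = dir_deriv X g P"
  unfolding dir_deriv_def using frechet_derivative_transform_within_open[OF assms(3,1,2,4)] by simp

lemma dir_deriv_const [simp]: "dir_deriv X (\<lambda>_. a) P = 0"
  by (simp add: dir_deriv_def)

lemma dir_deriv_add:
  assumes "f differentiable (at P)" "g differentiable (at P)"
  shows "dir_deriv X (\<lambda>Q. f Q + g Q) P = dir_deriv X f P + dir_deriv X g P"
proof -
  have "((\<lambda>Q. f Q + g Q) has_derivative
      (\<lambda>h. frechet_derivative f (at P) h + frechet_derivative g (at P) h)) (at P)"
    using assms by (intro has_derivative_add) (simp_all add: frechet_derivative_works)
  from frechet_derivative_at[OF this] show ?thesis
    by (simp add: dir_deriv_def) metis
qed

section \<open>Metric forms\<close>

lemma bounded_bilinear_matrix_vector_mult: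
  "bounded_bilinear ((*v) :: real^'n^'m \<Rightarrow> real^'n \<Rightarrow> real^'m)"
  unfolding bilinear_conv_bounded_bilinear[symmetric] bilinear_def
  by (auto intro!: linearI simp: algebra_simps scaleR_matrix_vector_assoc)

lemma metric_form_differentiable:
  assumes "G differentiable (at P)" "U differentiable (at P)" "V differentiable (at P)"
  shows "(\<lambda>Q. metric_form (G Q) (U Q) (V Q)) differentiable (at P)"
proof -
  from assms(1,3) have "(\<lambda>Q. G Q *v V Q) differentiable (at P)"
    unfolding differentiable_def
    using bounded_bilinear.FDERIV[OF bounded_bilinear_matrix_vector_mult] by blast
  with assms(2) show ?thesis
    unfolding metric_form_def by (rule differentiable_inner)
qed

lemma metric_form_continuous_on:
  assumes "continuous_on S G" "continuous_on S U" "continuous_on S V"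
  shows "continuous_on S (\<lambda>Q. metric_form (G Q) (U Q) (V Q))"
  unfolding metric_form_def
  by (intro continuous_on_inner assms
      bounded_bilinear.continuous_on[OF bounded_bilinear_matrix_vector_mult])

lemma metric_form_commute: "transpose G = G \<Longrightarrow> metric_form G u v = metric_form G v u"
  unfolding metric_form_def by (metis dot_lmul_matrix inner_commute transpose_matrix_vector)

lemma metric_form_add_left: "metric_form G (u + v) w = metric_form G u w + metric_form G v w"
  and metric_form_diff_left: "metric_form G (u - v) w = metric_form G u w - metric_form G v w"
  and metric_form_zero_left: "metric_form G 0 w = 0"
  by (simp_all add: metric_form_def inner_add_left inner_diff_left)

section \<open>The curvature of the Levi-Civita connection\<close>

text \<open>Add the first two of the four listed Bianchi identities and subtract the other two: the
  skew symmetries cancel all but twice \<open>K x y z u\<close> minus twice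
  \<open>K z u x y\<close>.\<close>

lemma curvature_tensor_pair_symmetry:
  fixes K :: "'a \<Rightarrow> 'a \<Rightarrow> 'a \<Rightarrow> 'a \<Rightarrow> 'b::linordered_field"
  assumes skew12: "\<And>x y z u. K x y z u = - K y x z u"
    and skew34: "\<And>x y z u. K x y z u = - K x y u z"
    and bianchi: "\<And>x y z u. K x y z u + K y z x u + K z x y u = 0"
  shows "K x y z u = K z u x y"
  using bianchi[of x y z u] bianchi[of y z u x] bianchi[of z u x y] bianchi[of u x y z]
    skew34[of y z u x] skew34[of z u y x] skew12[of u y z x]
    skew12[of u x z y] skew34[of x u z y] skew12[of x z u y] skew34[of z x u y]
    skew12[of u x y z] skew34[of x y u z] skew34[of y u x z]
  by linarith

locale levi_civita_chart =
  fixes F :: "(real^3) set" and G :: "real^3 \<Rightarrow> real^3^3" and nab :: connection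
  assumes open_F: "open F"
    and levi_civita: "levi_civita F G nab"
    and smooth_G: "smooth_on F G"
    and symmetric_G: "P \<in> F \<Longrightarrow> transpose (G P) = G P"
begin

section \<open>Rules for the connection in one chart\<close>

lemma nab_smooth: "smooth_on F X \<Longrightarrow> smooth_on F Y \<Longrightarrow> smooth_on F (nab X Y)"
  using levi_civita by (simp add: levi_civita_def affine_connection_def)

lemma nab_scale_left:
  assumes "smooth_on F f" "smooth_on F X" "smooth_on F Y" "P \<in> F"
  shows "nab (\<lambda>R. f R *\<^sub>R X R) Y P = f P *\<^sub>R nab X Y P"
  using levi_civita assms by (simp add: levi_civita_def affine_connection_def)

lemma nab_scale_right:
  assumes "smooth_on F f" "smooth_on F X" "smooth_on F Y" "P \<in> F"
  shows "nab X (\<lambda>R. f R *\<^sub>R Y R) P = dir_deriv X f P *\<^sub>R Y P + f P *\<^sub>R nab X Y P"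
  using levi_civita assms by (simp add: levi_civita_def affine_connection_def)

lemma nab_torsion_free:
  assumes "smooth_on F X" "smooth_on F Y" "P \<in> F"
  shows "nab X Y P - nab Y X P = lie_bracket X Y P"
  using levi_civita assms by (simp add: levi_civita_def)

lemma nab_metric:
  assumes "smooth_on F X" "smooth_on F Y" "smooth_on F Z" "P \<in> F"
  shows "dir_deriv X (\<lambda>R. metric_form (G R) (Y R) (Z R)) P =
    metric_form (G P) (nab X Y P) (Z P) + metric_form (G P) (Y P) (nab X Z P)"
  using levi_civita assms by (simp add: levi_civita_def)

text \<open>Fields are total functions, so \<open>nab X Y\<close> might a priori depend on the values of \<open>Y\<close> outside
  of \<open>F\<close>. The Leibniz rule for the indicator function of \<open>F\<close>, which is smooth on \<open>F\<close>, excludes this.\<close>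

lemma nab_cong_right:
  assumes X: "smooth_on F X" and Y: "smooth_on F Y"
    and eq: "\<And>Q. Q \<in> F \<Longrightarrow> Y Q = Y' Q" and P: "P \<in> F"
  shows "nab X Y P = nab X Y' P"
proof -
  define \<iota> :: "real^3 \<Rightarrow> real" where "\<iota> = indicator F"
  have \<iota>: "smooth_on F \<iota>"
    using smooth_on_cong[OF open_F, of "\<lambda>_. 1::real" \<iota>] by (simp add: \<iota>_def smooth_on_const)
  have "dir_deriv X \<iota> P = 0"
    using dir_deriv_cong[OF open_F P, of "\<lambda>_. 1::real" \<iota> X] by (simp add: \<iota>_def)
  moreover have "\<iota> P = 1"
    using P by (simp add: \<iota>_def)
  ultimately have *: "nab X (\<lambda>R. \<iota> R *\<^sub>R Z R) P = nab X Z P" if "smooth_on F Z" for Z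
    using nab_scale_right[OF \<iota> X that P] by simp
  have "smooth_on F Y'"
    using smooth_on_cong[OF open_F eq] Y by simp
  \<comment> \<open>Cutting off by the indicator makes the two fields equal as total
    functions.\<close>
  moreover have "(\<lambda>R. \<iota> R *\<^sub>R Y R) = (\<lambda>R. \<iota> R *\<^sub>R Y' R)"
    by (intro ext) (auto simp: \<iota>_def indicator_def eq)
  ultimately show ?thesis
    using *[OF Y] *[of Y'] by simp
qed

section \<open>Curvature on constant fields and its symmetries\<close>

lemma nab_zero_left: "smooth_on F Z \<Longrightarrow> P \<in> F \<Longrightarrow> nab (\<lambda>_. 0) Z P = 0"
  using nab_scale_left[of "\<lambda>_. 0" "\<lambda>_. 0" Z P] by (simp add: smooth_on_const)

lemma lie_bracket_const: "lie_bracket (\<lambda>_. x) (\<lambda>_. y) = (\<lambda>_. 0)"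
  by (simp add: lie_bracket_def)

lemma nab_const_commute: "P \<in> F \<Longrightarrow> nab (\<lambda>_. x) (\<lambda>_. y) P = nab (\<lambda>_. y) (\<lambda>_. x) P"
  using nab_torsion_free[of "\<lambda>_. x" "\<lambda>_. y" P] by (simp add: smooth_on_const lie_bracket_const)

text \<open>Fields with constant components have zero bracket, so only the commutator of covariant
  derivatives survives.\<close>

lemma curvature_const:
  assumes "smooth_on F Z" "P \<in> F"
  shows "curvature nab (\<lambda>_. x) (\<lambda>_. y) Z P =
    nab (\<lambda>_. x) (nab (\<lambda>_. y) Z) P - nab (\<lambda>_. y) (nab (\<lambda>_. x) Z) P"
  using assms by (simp add: curvature_def lie_bracket_const nab_zero_left)

lemma curvature4_skew12:
  assumes "P \<in> F"
  shows "curvature4 G nab P x y z u = - curvature4 G nab P y x z u"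
  using assms by (simp add: curvature4_def curvature_const smooth_on_const metric_form_diff_left)

lemma curvature4_bianchi:
  assumes "P \<in> F"
  shows "curvature4 G nab P x y z u + curvature4 G nab P y z x u + curvature4 G nab P z x y u = 0"
proof -
  \<comment> \<open>The inner fields agree only on \<open>F\<close>, by vanishing torsion, hence the
    appeal to \<open>nab_cong_right\<close>. The six second derivatives in the cyclic sum then
    cancel in pairs.\<close>
  have "nab (\<lambda>_. a) (nab (\<lambda>_. b) (\<lambda>_. c)) P = nab (\<lambda>_. a) (nab (\<lambda>_. c) (\<lambda>_. b)) P" for a b c
    by (intro nab_cong_right assms nab_const_commute nab_smooth smooth_on_const)
  then have "curvature nab (\<lambda>_. x) (\<lambda>_. y) (\<lambda>_. z) P + curvature nab (\<lambda>_. y) (\<lambda>_. z) (\<lambda>_. x) P +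
      curvature nab (\<lambda>_. z) (\<lambda>_. x) (\<lambda>_. y) P = 0"
    using assms by (simp add: curvature_const smooth_on_const)
  then show ?thesis
    by (simp add: curvature4_def metric_form_zero_left flip: metric_form_add_left)
qed

text \<open>Metric compatibility is applied twice. The two middle terms are swapped by exchanging
  \<open>x\<close> and \<open>y\<close>, so antisymmetrizing leaves only curvature terms.\<close>

lemma metric_second_derivative:
  fixes x y z u :: "real^3"
  defines "f \<equiv> \<lambda>R. metric_form (G R) z u"
  assumes P: "P \<in> F"
  shows "(\<lambda>R. frechet_derivative f (at R) y) differentiable (at P)"
    and "frechet_derivative (\<lambda>R. frechet_derivative f (at R) y) (at P) x =
      metric_form (G P) (nab (\<lambda>_. x) (nab (\<lambda>_. y) (\<lambda>_. z)) P) u +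
      metric_form (G P) (nab (\<lambda>_. y) (\<lambda>_. z) P) (nab (\<lambda>_. x) (\<lambda>_. u) P) +
      metric_form (G P) (nab (\<lambda>_. x) (\<lambda>_. z) P) (nab (\<lambda>_. y) (\<lambda>_. u) P) +
      metric_form (G P) z (nab (\<lambda>_. x) (nab (\<lambda>_. y) (\<lambda>_. u)) P)"
proof -
  \<comment> \<open>\<open>h\<close> and \<open>k\<close> are the two terms of the first derivative
    on \<open>F\<close>; each is again a metric product of smooth fields, ready for a second use of
    compatibility.\<close>
  define h where "h = (\<lambda>R. metric_form (G R) (nab (\<lambda>_. y) (\<lambda>_. z) R) u)"
  define k where "k = (\<lambda>R. metric_form (G R) z (nab (\<lambda>_. y) (\<lambda>_. u) R))"
  have f: "frechet_derivative f (at R) y = h R + k R" if "R \<in> F" for R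
    using nab_metric[of "\<lambda>_. y" "\<lambda>_. z" "\<lambda>_. u" R] that
    by (simp add: f_def h_def k_def dir_deriv_def smooth_on_const)
  have hk: "h differentiable (at P)" "k differentiable (at P)"
    unfolding h_def k_def
    by (intro metric_form_differentiable smooth_on_differentiable[OF _ P] smooth_G nab_smooth
        smooth_on_const)+
  then have "(\<lambda>R. h R + k R) differentiable (at P)"
    by simp
  then show "(\<lambda>R. frechet_derivative f (at R) y) differentiable (at P)"
    by (rule differentiable_transform_within_open[OF _ open_F P]) (simp add: f)
  then have "dir_deriv (\<lambda>_. x) (\<lambda>R. frechet_derivative f (at R) y) P =
      dir_deriv (\<lambda>_. x) (\<lambda>R. h R + k R) P"
    by (rule dir_deriv_cong[OF open_F P]) (rule f)
  then have "frechet_derivative (\<lambda>R. frechet_derivative f (at R) y) (at P) x =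
      dir_deriv (\<lambda>_. x) (\<lambda>R. h R + k R) P"
    by (simp add: dir_deriv_def)
  also have "\<dots> = dir_deriv (\<lambda>_. x) h P + dir_deriv (\<lambda>_. x) k P"
    by (rule dir_deriv_add[OF hk])
  also have "dir_deriv (\<lambda>_. x) h P =
      metric_form (G P) (nab (\<lambda>_. x) (nab (\<lambda>_. y) (\<lambda>_. z)) P) u +
      metric_form (G P) (nab (\<lambda>_. y) (\<lambda>_. z) P) (nab (\<lambda>_. x) (\<lambda>_. u) P)"
    unfolding h_def by (intro nab_metric nab_smooth smooth_on_const P)
  also have "dir_deriv (\<lambda>_. x) k P =
      metric_form (G P) (nab (\<lambda>_. x) (\<lambda>_. z) P) (nab (\<lambda>_. y) (\<lambda>_. u) P) +
      metric_form (G P) z (nab (\<lambda>_. x) (nab (\<lambda>_. y) (\<lambda>_. u)) P)"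
    unfolding k_def by (intro nab_metric nab_smooth smooth_on_const P)
  finally show "frechet_derivative (\<lambda>R. frechet_derivative f (at R) y) (at P) x =
      metric_form (G P) (nab (\<lambda>_. x) (nab (\<lambda>_. y) (\<lambda>_. z)) P) u +
      metric_form (G P) (nab (\<lambda>_. y) (\<lambda>_. z) P) (nab (\<lambda>_. x) (\<lambda>_. u) P) +
      metric_form (G P) (nab (\<lambda>_. x) (\<lambda>_. z) P) (nab (\<lambda>_. y) (\<lambda>_. u) P) +
      metric_form (G P) z (nab (\<lambda>_. x) (nab (\<lambda>_. y) (\<lambda>_. u)) P)"
    by simp
qed

text \<open>The second derivatives of the function \<open>g(z,u)\<close> commute; written through
  the connection, their difference is R(x,y,z,u) + R(x,y,u,z).\<close>

lemma curvature4_skew34: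
  assumes P: "P \<in> F"
  shows "curvature4 G nab P x y z u = - curvature4 G nab P x y u z"
proof -
  define f where "f = (\<lambda>R. metric_form (G R) z u)"
  note second = metric_second_derivative[where z = z and u = u, folded f_def]
  \<comment> \<open>Continuity of the mixed derivatives is read off from their expression through
    the connection.\<close>
  have cont: "continuous_on F (\<lambda>Q. frechet_derivative (\<lambda>R. frechet_derivative f (at R) b) (at Q) a)"
    for a b
  proof -
    have "continuous_on F (\<lambda>P.
      metric_form (G P) (nab (\<lambda>_. a) (nab (\<lambda>_. b) (\<lambda>_. z)) P) u +
      metric_form (G P) (nab (\<lambda>_. b) (\<lambda>_. z) P) (nab (\<lambda>_. a) (\<lambda>_. u) P) +
      metric_form (G P) (nab (\<lambda>_. a) (\<lambda>_. z) P) (nab (\<lambda>_. b) (\<lambda>_. u) P) +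
      metric_form (G P) z (nab (\<lambda>_. a) (nab (\<lambda>_. b) (\<lambda>_. u)) P))"
      by (intro continuous_on_add metric_form_continuous_on smooth_on_continuous_on smooth_G
          nab_smooth smooth_on_const)
    then show ?thesis
      by (simp add: second(2) cong: continuous_on_cong)
  qed
  have "frechet_derivative (\<lambda>R. frechet_derivative f (at R) y) (at P) x =
      frechet_derivative (\<lambda>R. frechet_derivative f (at R) x) (at P) y"
  proof (rule frechet_derivative_commute[OF open_F P _ second(1) second(1) cont cont])
    show "f differentiable (at Q)" if "Q \<in> F" for Q
      unfolding f_def using that
      by (intro metric_form_differentiable smooth_on_differentiable[of F] smooth_G smooth_on_const)
  qed
  then show ?thesis
    using P metric_form_commute[OF symmetric_G[OF P], of _ z]
    by (simp add: second(2) curvature4_def curvature_const smooth_on_const metric_form_diff_left)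
qed

lemma curvature4_pair_symmetry:
  "P \<in> F \<Longrightarrow> curvature4 G nab P x y z u = curvature4 G nab P z u x y"
  by (rule curvature_tensor_pair_symmetry)
    (rule curvature4_skew12 curvature4_skew34 curvature4_bianchi, assumption)+

section \<open>Invariance under parallel isometries\<close>

text \<open>Since \<open>Q\<close> has constant components \<open>T\<close> on \<open>F\<close>,
  applying it to a constant field gives a constant field, which matches the evaluation of
  \<open>curvature4\<close> on constant extensions.\<close>

lemma curvature4_parallel_isometry:
  assumes parallel: "parallel_on F nab Q" and const: "\<And>R. R \<in> F \<Longrightarrow> Q R = T"
    and P: "P \<in> F"
    and isometry: "\<And>u v. metric_form (G P) (tensor_apply T u) (tensor_apply T v) = metric_form (G P) u v"
  shows "curvature4 G nab P (tensor_apply T x) (tensor_apply T y) (tensor_apply T z) (tensor_apply T u) =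
    curvature4 G nab P x y z u"
proof -
  \<comment> \<open>Parallelism concerns \<open>Q R\<close>, which equals \<open>T\<close> only on
    \<open>F\<close>; \<open>nab_cong_right\<close> bridges the two.\<close>
  have nab: "nab X (\<lambda>R. tensor_apply T (Y R)) R = tensor_apply T (nab X Y R)"
    if "smooth_on F X" "smooth_on F Y" "smooth_on F (\<lambda>R. tensor_apply T (Y R))" "R \<in> F" for X Y R
  proof -
    have "nab X (\<lambda>R. tensor_apply T (Y R)) R = nab X (\<lambda>R. tensor_apply (Q R) (Y R)) R"
      using that const by (intro nab_cong_right) simp_all
    also have "\<dots> = tensor_apply T (nab X Y R)"
      using parallel that const by (simp add: parallel_on_def cov_deriv_tensor_def)
    finally show ?thesis .
  qed
  have nab_nab: "nab (\<lambda>_. a) (nab (\<lambda>_. b) (\<lambda>_. tensor_apply T c)) P =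
      tensor_apply T (nab (\<lambda>_. a) (nab (\<lambda>_. b) (\<lambda>_. c)) P)" for a b c
  proof -
    have eq: "nab (\<lambda>_. b) (\<lambda>_. tensor_apply T c) R = tensor_apply T (nab (\<lambda>_. b) (\<lambda>_. c) R)"
      if "R \<in> F" for R
      using that by (intro nab smooth_on_const)
    \<comment> \<open>The image under \<open>T\<close> of the field \<open>nab b c\<close> is smooth
      because it agrees on \<open>F\<close> with this covariant derivative.\<close>
    have smooth: "smooth_on F (nab (\<lambda>_. b) (\<lambda>_. tensor_apply T c))"
      by (intro nab_smooth smooth_on_const)
    then have "nab (\<lambda>_. a) (nab (\<lambda>_. b) (\<lambda>_. tensor_apply T c)) P =
        nab (\<lambda>_. a) (\<lambda>R. tensor_apply T (nab (\<lambda>_. b) (\<lambda>_. c) R)) P"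
      using P eq by (intro nab_cong_right smooth_on_const)
    also have "\<dots> = tensor_apply T (nab (\<lambda>_. a) (nab (\<lambda>_. b) (\<lambda>_. c)) P)"
      using smooth smooth_on_cong[OF open_F eq] P by (intro nab nab_smooth smooth_on_const) simp_all
    finally show ?thesis .
  qed
  have *: "curvature4 G nab P a b (tensor_apply T c) (tensor_apply T d) = curvature4 G nab P a b c d"
    for a b c d
  proof -
    have "curvature nab (\<lambda>_. a) (\<lambda>_. b) (\<lambda>_. tensor_apply T c) P =
        tensor_apply T (curvature nab (\<lambda>_. a) (\<lambda>_. b) (\<lambda>_. c) P)"
      using P by (simp add: curvature_const smooth_on_const nab_nab)
        (simp add: tensor_apply_def algebra_simps)
    then show ?thesis
      by (simp add: curvature4_def isometry)
  qed
  \<comment> \<open>R(Tx,Ty,Tz,Tu) = R(Tx,Ty,z,u) = R(z,u,Tx,Ty) = R(z,u,x,y) = R(x,y,z,u).\<close>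
  show ?thesis
    using * curvature4_pair_symmetry[OF P] by metis
qed

lemma sectional_curvature_parallel_isometry:
  assumes "parallel_on F nab Q" "\<And>R. R \<in> F \<Longrightarrow> Q R = T" "P \<in> F"
    and "\<And>u v. metric_form (G P) (tensor_apply T u) (tensor_apply T v) = metric_form (G P) u v"
  shows "sectional_curvature G nab P (tensor_apply T x) (tensor_apply T y) =
    sectional_curvature G nab P x y"
  by (simp add: sectional_curvature_def assms(4) curvature4_parallel_isometry[OF assms])

end

section \<open>The cyclic permutation tensor\<close>

abbreviation (input) cyclic_matrix :: "real^3^3" where
  "cyclic_matrix \<equiv> vector [vector [0, 1, 0], vector [0, 0, 1], vector [1, 0, 0]]"

text \<open>The basis is permuted as e1 to e2 to e3 to e1, so components shift one place to the
  right.\<close>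

lemma tensor_apply_cyclic_matrix: "tensor_apply cyclic_matrix x = vector [x$3, x$1, x$2]"
  by (simp add: tensor_apply_def vec_eq_iff forall_3 vector_matrix_mult_def sum_3 vector_3)

text \<open>Equal diagonal and equal off-diagonal entries make the form invariant under any
  simultaneous permutation of coordinates.\<close>

lemma metric_form_cyclic_matrix:
  fixes a b :: real
  defines "G \<equiv> vector [vector [a, b, b], vector [b, a, b], vector [b, b, a]]"
  shows "metric_form G (tensor_apply cyclic_matrix u) (tensor_apply cyclic_matrix v) = metric_form G u v"
  unfolding tensor_apply_cyclic_matrix
  by (simp add: G_def metric_form_def inner_vec_def matrix_vector_mult_def sum_3 vector_3)
    (simp add: algebra_simps)

theorem theorem3:
  fixes \<A> :: "('m::{t2_space,second_countable_topology}) chart set"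
    and g q :: "'m chart \<Rightarrow> real^3 \<Rightarrow> real^3^3"
    and nab :: "'m chart \<Rightarrow> connection"
    and c :: "'m chart"
    and A B :: "real^3 \<Rightarrow> real"
    and p :: 'm
    and x :: "real^3"
  assumes "smooth_atlas \<A>"
    and "riemannian_metric \<A> g"
    and "tensor_field_11 \<A> q"
    and "levi_civita_connection \<A> g nab"
    and "parallel_tensor \<A> nab q"
    and "c \<in> \<A>" and "p \<in> fst c"
    and "smooth_on (chart_image c) A" and "smooth_on (chart_image c) B"
    and "\<forall>P\<in>chart_image c. A P > B P \<and> B P > 0"
    and "\<forall>P\<in>chart_image c. g c P =
           vector [vector [A P, B P, B P],
                   vector [B P, A P, B P],
                   vector [B P, B P, A P]]"
    and "\<forall>P\<in>chart_image c. q c P =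
           vector [vector [0, 1, 0],
                   vector [0, 0, 1],
                   vector [1, 0, 0]]"
    and "3 * x$1 * x$2 * x$3 \<noteq> (x$1)^3 + (x$2)^3 + (x$3)^3"
  shows "let P = snd c p;
             \<mu> = sectional_curvature (g c) (nab c) P;
             qx = tensor_apply (q c P) x;
             qqx = tensor_apply (q c P) qx
         in \<mu> x qx = \<mu> qx qqx \<and> \<mu> qx qqx = \<mu> qqx x"
proof -
  let ?F = "chart_image c" and ?P = "snd c p"
  interpret levi_civita_chart ?F "g c" "nab c"
    using assms(1,2,4,6)
    unfolding smooth_atlas_def riemannian_metric_def levi_civita_connection_def
    by (intro levi_civita_chart.intro) blast+
  have P: "?P \<in> ?F"
    using assms(7) by (simp add: chart_image_def)
  have parallel: "parallel_on ?F (nab c) (q c)"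
    using assms(5,6) by (simp add: parallel_tensor_def)
  have invariant: "sectional_curvature (g c) (nab c) ?P
      (tensor_apply cyclic_matrix u) (tensor_apply cyclic_matrix v) =
    sectional_curvature (g c) (nab c) ?P u v" for u v
  proof (rule sectional_curvature_parallel_isometry[OF parallel _ P])
    show "q c R = cyclic_matrix" if "R \<in> ?F" for R
      using assms(12) that by blast
    show "metric_form (g c ?P) (tensor_apply cyclic_matrix u) (tensor_apply cyclic_matrix v) =
        metric_form (g c ?P) u v" for u v
      using assms(11) P by (simp add: metric_form_cyclic_matrix)
  qed
  \<comment> \<open>The cube of the shift is the identity, so invariance applied to
    \<open>qx\<close> and \<open>qqx\<close> ends at the pair \<open>qqx\<close>, \<open>x\<close>,
    in the order required.\<close>
  have "tensor_apply cyclic_matrix (tensor_apply cyclic_matrix (tensor_apply cyclic_matrix x)) = x"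
    by (simp add: tensor_apply_cyclic_matrix vec_eq_iff forall_3 vector_3)
  moreover have "q c ?P = cyclic_matrix"
    using assms(12) P by blast
  ultimately show ?thesis
    using invariant[of x "tensor_apply cyclic_matrix x"]
      invariant[of "tensor_apply cyclic_matrix x"
        "tensor_apply cyclic_matrix (tensor_apply cyclic_matrix x)"]
    by (simp add: Let_def)
qed

end
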